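(* Let $L\ge 1$, let $B=(b_1,\dots,b_L)$ be a sequence of integers $b_i\ge 2$, $P=\prod_{i=1}^L b_i$ and $k=\lceil\log_2 P\rceil$. The expected number of bits consumed by the rejection sampler $\mathcal{S}(B)$, run on a source of independent uniform random bits, satisfies $$\mathbb{E}[\text{bits}]=k\cdot\frac{2^k}{P}\le 2k=2\lceil\log_2 P\rceil .$$
   Context: The rejection sampler $\mathcal{S}(B)$: (1) draw $k$ fresh bits from the source $\mathcal{R}$ and interpret them as an integer $V\in\{0,\dots,2^k-1\}$; (2) if $V\ge P$, discard $V$ and return to step 1; (3) otherwise apply the inverse Horner decomposition to $V$ (for $i=L,\dots,1$: $k_i=V\bmod b_i$, then $V\leftarrow\lfloor V/b_i\rfloor$) and return $(k_1,\dots,k_L)$. The number of bits consumed is $k$ times the number of rounds of step 1 performed. *)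

theory Defs
  imports "HOL-Probability.Probability"
begin

text \<open>
  The source is an infinite bit sequence \<open>r\<close>; a block of bits is read as an integer with the
  least significant bit first. The list \<open>B\<close> is \<open>[b\<^sub>1, \<dots>, b\<^sub>L]\<close>.
\<close>

definition block_width :: "nat list \<Rightarrow> nat" where
  "block_width B = nat \<lceil>log 2 (real (prod_list B))\<rceil>"

definition draw :: "nat \<Rightarrow> (nat \<Rightarrow> bool) \<Rightarrow> nat \<Rightarrow> nat" where
  "draw k r j = horner_sum of_bool 2 (map r [j * k ..< j * k + k])"

text \<open>
  The remainders are produced in the order \<open>k\<^sub>L, \<dots>, k\<^sub>1\<close>, so the bases are consumed in reverse
  and the resulting list is reversed back.
\<close>

fun remainders :: "nat list \<Rightarrow> nat \<Rightarrow> nat list" where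
  "remainders [] V = []"
| "remainders (b # bs) V = (V mod b) # remainders bs (V div b)"

definition inverse_horner :: "nat list \<Rightarrow> nat \<Rightarrow> nat list" where
  "inverse_horner B V = rev (remainders (rev B) V)"

text \<open>
  \<open>sampler_loop B r j\<close> continues the sampler after \<open>j\<close> rejected rounds and returns the sample
  together with the total number of rounds performed; it is \<open>None\<close> if every further draw is
  rejected, i.e. if the sampler runs forever.
\<close>

partial_function (option) sampler_loop ::
    "nat list \<Rightarrow> (nat \<Rightarrow> bool) \<Rightarrow> nat \<Rightarrow> (nat list \<times> nat) option" where
  "sampler_loop B r j =
     (let V = draw (block_width B) r j in
      if V \<ge> prod_list B then sampler_loop B r (Suc j)
      else Some (inverse_horner B V, Suc j))"

definition rejection_sampler :: "nat list \<Rightarrow> (nat \<Rightarrow> bool) \<Rightarrow> (nat list \<times> nat) option" where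
  "rejection_sampler B r = sampler_loop B r 0"

definition rounds :: "nat list \<Rightarrow> (nat \<Rightarrow> bool) \<Rightarrow> enat" where
  "rounds B r = (case rejection_sampler B r of None \<Rightarrow> \<infinity> | Some (_, n) \<Rightarrow> enat n)"

definition bits_consumed :: "nat list \<Rightarrow> (nat \<Rightarrow> bool) \<Rightarrow> enat" where
  "bits_consumed B r = enat (block_width B) * rounds B r"

definition fair_bit_source :: "'a measure \<Rightarrow> (nat \<Rightarrow> 'a \<Rightarrow> bool) \<Rightarrow> bool" where
  "fair_bit_source M R \<longleftrightarrow>
     prob_space M \<and>
     prob_space.indep_vars M (\<lambda>_. count_space UNIV) R UNIV \<and>
     (\<forall>i. distr M (count_space UNIV) (R i) = uniform_count_measure UNIV)"

end

theory Submission imports Defs begin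

text \<open>
  The sampler performs more than \<open>n\<close> rounds exactly when its first \<open>n\<close> draws are all rejected,
  an event that depends only on the first \<open>n * k\<close> bits. Counting bit strings, it has
  probability \<open>(1 - P / 2 ^ k) ^ n\<close>. The expected number of rounds is the sum of these tail
  probabilities, a geometric series with value \<open>2 ^ k / P\<close>; and \<open>2 ^ k < 2 * P\<close> by the choice
  of \<open>k\<close>.
\<close>

section \<open>From the recursion to the sequence of draws\<close>

text \<open>Fixpoint induction on the partial function. Contrapositively, a stream without any
  accepted draw makes the loop run forever.\<close>

lemma sampler_loop_SomeD:
  "sampler_loop B r j = Some y \<Longrightarrow> \<exists>i. draw (block_width B) r i < prod_list B"
  by (induction rule: sampler_loop.raw_induct[rotated, consumes 1])
     (auto simp: Let_def not_le split: if_splits)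

text \<open>Induction downwards from the accepting index \<open>m\<close>, unfolding the loop once
  per step. Rounds are counted from the start of the stream, so the count is \<open>Suc m\<close>
  whatever \<open>j\<close> is.\<close>

lemma sampler_loop_eq_Some:
  assumes "j \<le> m" "draw (block_width B) r m < prod_list B"
    and "\<And>i. j \<le> i \<Longrightarrow> i < m \<Longrightarrow> prod_list B \<le> draw (block_width B) r i"
  shows "\<exists>s. sampler_loop B r j = Some (s, Suc m)"
  using assms
proof (induction j rule: inc_induct)
  case base
  then show ?case by (subst sampler_loop.simps) (auto simp: Let_def)
next
  case (step j)
  then have "prod_list B \<le> draw (block_width B) r j" by auto
  with step show ?case by (subst sampler_loop.simps) (auto simp: Let_def)
qed

text \<open>If \<open>m\<close> is the least accepted index, the round count is
  \<open>m + 1\<close>, and \<open>n < m + 1\<close> says that no index below \<open>n\<close> is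
  accepted. If there is none, the count is infinite and both sides hold for every
  \<open>n\<close>.\<close>

lemma less_rounds_iff:
  "enat n < rounds B r \<longleftrightarrow> (\<forall>i<n. prod_list B \<le> draw (block_width B) r i)"
proof (cases "\<exists>i. draw (block_width B) r i < prod_list B")
  case True
  define m where "m = (LEAST i. draw (block_width B) r i < prod_list B)"
  have m: "draw (block_width B) r m < prod_list B"
    using True unfolding m_def by (rule LeastI_ex)
  have less: "prod_list B \<le> draw (block_width B) r i" if "i < m" for i
    using not_less_Least[OF that[unfolded m_def]] by simp
  obtain s where "rejection_sampler B r = Some (s, Suc m)"
    using sampler_loop_eq_Some[of 0 m B r] m less unfolding rejection_sampler_def by auto
  then show ?thesis
    using m less unfolding rounds_def by (auto simp: less_Suc_eq_le) (meson leD leI)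
next
  case False
  then have "rejection_sampler B r = None"
    using sampler_loop_SomeD unfolding rejection_sampler_def by fastforce
  with False show ?thesis by (auto simp: rounds_def not_less)
qed

section \<open>Counting rejected bit strings\<close>

text \<open>The Horner sum is binary notation with the least significant bit first; reading off the
  \<open>k\<close> lowest bits inverts it.\<close>

lemma bij_betw_horner_sum_of_bool:
  "bij_betw (horner_sum of_bool 2) {bs. length bs = k} {..<2 ^ k :: nat}"
proof (rule bij_betw_byWitness[where f' = "\<lambda>v. map (bit v) [0..<k]"])
  show "\<forall>bs\<in>{bs. length bs = k}. map (bit (horner_sum of_bool 2 bs :: nat)) [0..<k] = bs"
    by (auto intro!: nth_equalityI simp: bit_horner_sum_bit_iff)
  show "\<forall>v\<in>{..<2 ^ k :: nat}. horner_sum of_bool 2 (map (bit v) [0..<k]) = v"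
    by (auto simp: horner_sum_bit_eq_take_bit take_bit_nat_eq_self)
  show "horner_sum of_bool 2 ` {bs. length bs = k} \<subseteq> {..<2 ^ k :: nat}"
    using horner_sum_of_bool_2_less by auto
qed auto

lemma card_rejected_blocks:
  assumes "P \<le> 2 ^ k"
  shows "card {bs. length bs = k \<and> P \<le> horner_sum of_bool 2 bs} = 2 ^ k - P"
proof -
  have "bij_betw (horner_sum of_bool 2)
      {bs \<in> {bs. length bs = k}. P \<le> horner_sum of_bool 2 bs} {v \<in> {..<2 ^ k}. P \<le> v}"
    by (rule bij_betw_Collect[OF bij_betw_horner_sum_of_bool]) simp
  then have "card {bs. length bs = k \<and> P \<le> horner_sum of_bool 2 bs} = card {v \<in> {..<2 ^ k}. P \<le> v}"
    by (simp add: bij_betw_same_card)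
  also have "{v \<in> {..<2 ^ k}. P \<le> v} = {P..<2 ^ k}" by auto
  finally show ?thesis by simp
qed

text \<open>The event of \<open>n\<close> rejections as a finite set of bit strings, so that its
  probability becomes a cardinality.\<close>

definition rejected_prefixes :: "nat \<Rightarrow> nat \<Rightarrow> nat \<Rightarrow> bool list set" where
  "rejected_prefixes P k n =
     {bs. length bs = n * k \<and> (\<forall>i<n. P \<le> horner_sum of_bool 2 (take k (drop (i * k) bs)))}"

text \<open>Splitting off the first block gives the product structure behind the power in the
  count.\<close>

lemma rejected_prefixes_Suc:
  "rejected_prefixes P k (Suc n) = (\<lambda>(xs, ys). xs @ ys) `
     ({bs. length bs = k \<and> P \<le> horner_sum of_bool 2 bs} \<times> rejected_prefixes P k n)"
proof (intro equalityI subsetI)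
  fix bs assume "bs \<in> rejected_prefixes P k (Suc n)"
  then have len: "length bs = k + n * k"
    and rej: "\<And>i. i < Suc n \<Longrightarrow> P \<le> horner_sum of_bool 2 (take k (drop (i * k) bs))"
    by (auto simp: rejected_prefixes_def)
  have "take k bs \<in> {bs. length bs = k \<and> P \<le> horner_sum of_bool 2 bs}"
    using len rej[of 0] by simp
  moreover have "drop k bs \<in> rejected_prefixes P k n"
    using len rej[of "Suc i" for i] by (auto simp: rejected_prefixes_def add.commute)
  ultimately show "bs \<in> (\<lambda>(xs, ys). xs @ ys) `
     ({bs. length bs = k \<and> P \<le> horner_sum of_bool 2 bs} \<times> rejected_prefixes P k n)"
    by (intro image_eqI[where x = "(take k bs, drop k bs)"]) auto
qed (auto simp: rejected_prefixes_def less_Suc_eq_0_disj)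

lemma card_rejected_prefixes:
  assumes "P \<le> 2 ^ k"
  shows "card (rejected_prefixes P k n) = (2 ^ k - P) ^ n"
proof (induction n)
  case 0
  then show ?case by (simp add: rejected_prefixes_def)
next
  case (Suc n)
  \<comment> \<open>A concatenation determines its two parts because every first part has length
    \<open>k\<close>.\<close>
  have "inj_on (\<lambda>(xs, ys). xs @ ys)
      ({bs. length bs = k \<and> P \<le> horner_sum of_bool 2 bs} \<times> rejected_prefixes P k n)"
    by (auto simp: inj_on_def)
  with Suc show ?case
    by (simp add: rejected_prefixes_Suc card_image card_cartesian_product
        card_rejected_blocks[OF assms])
qed

lemma map_mem_rejected_prefixes_iff:
  "map r [0..<n * k] \<in> rejected_prefixes P k n \<longleftrightarrow> (\<forall>i<n. P \<le> draw k r i)"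
proof -
  have "take k (drop (i * k) (map r [0..<n * k])) = map r [i * k..<i * k + k]" if "i < n" for i
  proof -
    have "i * k + k \<le> n * k"
      using mult_le_mono1[of "Suc i" n k] that by simp
    then show ?thesis by (simp add: drop_map take_map)
  qed
  then show ?thesis by (simp add: rejected_prefixes_def draw_def)
qed

section \<open>Probability of the tail events\<close>

text \<open>The first \<open>N\<close> bits are uniform on the strings of length \<open>N\<close>:
  by independence each string has probability \<open>1 / 2 ^ N\<close>, and the finite set
  \<open>S\<close> is a disjoint union of singletons.\<close>

lemma fair_bit_source_prefix:
  assumes "fair_bit_source M R" and S: "\<And>bs. bs \<in> S \<Longrightarrow> length bs = N"
  shows "{\<omega> \<in> space M. map (\<lambda>i. R i \<omega>) [0..<N] \<in> S} \<in> sets M" (is "?E S \<in> _")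
    and "measure M {\<omega> \<in> space M. map (\<lambda>i. R i \<omega>) [0..<N] \<in> S} = card S / 2 ^ N"
proof -
  interpret prob_space M using assms(1) by (simp add: fair_bit_source_def)
  have indep: "indep_vars (\<lambda>_. count_space UNIV) R UNIV"
    and distr: "distr M (count_space UNIV) (R i) = uniform_count_measure UNIV" for i
    using assms(1) by (auto simp: fair_bit_source_def)
  have R[measurable]: "R i \<in> M \<rightarrow>\<^sub>M count_space UNIV" for i
    using indep by (auto simp: indep_vars_def)
  have bit: "prob (R i -` {b} \<inter> space M) = 1 / 2" for i b
  proof -
    have "prob (R i -` {b} \<inter> space M) = measure (distr M (count_space UNIV) (R i)) {b}"
      by (simp add: measure_distr)
    then show ?thesis by (simp add: distr measure_uniform_count_measure)
  qed
  have single_sets: "?E {bs} \<in> sets M" if "length bs = N" for bs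
  proof -
    have "?E {bs} = {\<omega> \<in> space M. \<forall>i<N. R i \<omega> = bs ! i}"
      using that by (auto simp: list_eq_iff_nth_eq)
    also have "\<dots> \<in> sets M" by measurable
    finally show ?thesis .
  qed
  have single: "prob (?E {bs}) = 1 / 2 ^ N" if "length bs = N" for bs
  \<comment> \<open>For \<open>N = 0\<close> the event is all of \<open>space M\<close>; the product
    rule for independent variables is applied to a nonempty index set.\<close>
  proof (cases "N = 0")
    case True
    then show ?thesis using that prob_space by simp
  next
    case False
    then have "?E {bs} = (\<Inter>i\<in>{..<N}. R i -` {bs ! i} \<inter> space M)"
      using that by (auto simp: list_eq_iff_nth_eq)
    also have "prob \<dots> = (\<Prod>i<N. prob (R i -` {bs ! i} \<inter> space M))"
      using False by (intro indep_varsD[OF indep]) auto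
    finally show ?thesis by (simp add: bit power_one_over)
  qed
  have fin: "finite S"
    by (rule finite_subset[OF _ finite_lists_length_eq[of "UNIV :: bool set" N]]) (auto simp: S)
  have E: "?E S = (\<Union>bs\<in>S. ?E {bs})" by auto
  show "?E S \<in> sets M"
    unfolding E using fin S single_sets by (intro sets.finite_UN) auto
  have "prob (?E S) = (\<Sum>bs\<in>S. prob (?E {bs}))"
    unfolding E using S single_sets
    by (intro finite_measure_finite_Union fin) (auto simp: disjoint_family_on_def)
  also have "\<dots> = (\<Sum>bs\<in>S. 1 / 2 ^ N)" using S by (intro sum.cong refl single)
  finally show "prob (?E S) = card S / 2 ^ N" by simp
qed

lemma rounds_tail:
  assumes "fair_bit_source M R" and "prod_list B \<le> 2 ^ block_width B"
  shows "{\<omega> \<in> space M. enat n < rounds B (\<lambda>i. R i \<omega>)} \<in> sets M"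
    and "measure M {\<omega> \<in> space M. enat n < rounds B (\<lambda>i. R i \<omega>)}
           = (1 - real (prod_list B) / 2 ^ block_width B) ^ n"
proof -
  let ?P = "prod_list B" and ?k = "block_width B"
  let ?S = "rejected_prefixes ?P ?k n"
  have eq: "{\<omega> \<in> space M. enat n < rounds B (\<lambda>i. R i \<omega>)}
      = {\<omega> \<in> space M. map (\<lambda>i. R i \<omega>) [0..<n * ?k] \<in> ?S}"
    by (simp add: less_rounds_iff map_mem_rejected_prefixes_iff)
  have len: "length bs = n * ?k" if "bs \<in> ?S" for bs
    using that by (simp add: rejected_prefixes_def)
  show "{\<omega> \<in> space M. enat n < rounds B (\<lambda>i. R i \<omega>)} \<in> sets M"
    unfolding eq by (rule fair_bit_source_prefix[OF assms(1) len])
  have "measure M {\<omega> \<in> space M. enat n < rounds B (\<lambda>i. R i \<omega>)} = card ?S / 2 ^ (n * ?k)"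
    unfolding eq by (rule fair_bit_source_prefix[OF assms(1) len])
  \<comment> \<open>Since \<open>P \<le> 2 ^ k\<close>, the truncated subtraction in the count
    agrees with the real one.\<close>
  also have "\<dots> = ((2 ^ ?k - real ?P) / 2 ^ ?k) ^ n"
    using assms(2) by (simp add: card_rejected_prefixes of_nat_diff power_divide
        mult.commute[of n] power_mult)
  also have "(2 ^ ?k - real ?P) / 2 ^ ?k = 1 - real ?P / 2 ^ ?k"
    by (simp add: diff_divide_distrib)
  finally show "measure M {\<omega> \<in> space M. enat n < rounds B (\<lambda>i. R i \<omega>)}
      = (1 - real ?P / 2 ^ ?k) ^ n" .
qed

section \<open>Expected number of rounds\<close>

text \<open>As \<open>enat\<close> is countable, measurable preimages of points suffice, and each is
  a countable combination of tail events.\<close>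

lemma measurable_enat_tails:
  fixes f :: "'a \<Rightarrow> enat"
  assumes [measurable]: "\<And>n. Measurable.pred M (\<lambda>x. enat n < f x)"
  shows "f \<in> M \<rightarrow>\<^sub>M count_space UNIV"
proof -
  \<comment> \<open>An extended natural is determined by the finite numbers strictly below it,
    \<infinity> being above all of them.\<close>
  have eq: "f x = a \<longleftrightarrow> (\<forall>n. enat n < f x \<longleftrightarrow> enat n < a)" for x a
    by (metis enat_ord_code(4) less_irrefl linorder_neqE enat.exhaust)
  have "f -` {a} \<inter> space M \<in> sets M" for a
  proof -
    have "f -` {a} \<inter> space M = {x \<in> space M. \<forall>n. enat n < f x \<longleftrightarrow> enat n < a}"
      using eq by auto
    also have "\<dots> \<in> sets M" by measurable
    finally show ?thesis .
  qed
  then show ?thesis by (subst measurable_count_space_eq2_countable) auto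
qed

lemma measurable_rounds:
  assumes "fair_bit_source M R" and "prod_list B \<le> 2 ^ block_width B"
  shows "(\<lambda>\<omega>. rounds B (\<lambda>i. R i \<omega>)) \<in> M \<rightarrow>\<^sub>M count_space UNIV"
  using rounds_tail(1)[OF assms] by (intro measurable_enat_tails) (simp add: pred_def)

text \<open>Tail-sum formula: the expectation is the sum over \<open>n\<close> of the probabilities
  of more than \<open>n\<close> rounds. The ratio \<open>?q\<close> is the probability of rejecting
  one draw, so \<open>1 - ?q\<close> is \<open>P / 2 ^ k\<close>.\<close>

lemma expected_rounds:
  assumes "fair_bit_source M R" and "prod_list B \<le> 2 ^ block_width B" and "0 < prod_list B"
  shows "(\<integral>\<^sup>+\<omega>. ennreal_of_enat (rounds B (\<lambda>i. R i \<omega>)) \<partial>M)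
           = ennreal (2 ^ block_width B / real (prod_list B))"
proof -
  interpret prob_space M using assms(1) by (simp add: fair_bit_source_def)
  let ?q = "1 - real (prod_list B) / 2 ^ block_width B"
  have "real (prod_list B) \<le> 2 ^ block_width B"
    using assms(2) by (metis of_nat_le_iff of_nat_numeral of_nat_power)
  then have q: "0 \<le> ?q" "?q < 1" using assms(3) by auto
  have "(\<lambda>n. ?q ^ n) sums (1 / (1 - ?q))"
    using q by (intro geometric_sums) auto
  then have "(\<Sum>n. ennreal (?q ^ n)) = ennreal (2 ^ block_width B / real (prod_list B))"
    using q by (intro suminf_ennreal_eq) auto
  then show ?thesis
    by (simp add: nn_integral_enat_function[OF measurable_rounds[OF assms(1,2)]]
        emeasure_eq_measure rounds_tail[OF assms(1,2)])
qed

section \<open>Arithmetic of the block width and the final bound\<close>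

text \<open>In the case of zero times infinity both types use the value 0.\<close>

lemma ennreal_of_enat_mult_enat: "ennreal_of_enat (enat k * x) = of_nat k * ennreal_of_enat x"
  by (cases x) (auto simp: ennreal_mult_top zero_enat_def[symmetric])

text \<open>From \<open>2 \<le> P\<close> the logarithm is at least 1, so converting its ceiling to
  \<open>nat\<close> loses nothing; the two bounds on \<open>2 ^ k\<close> exponentiate those on the
  ceiling.\<close>

lemma block_width_bounds:
  assumes "2 \<le> prod_list B"
  shows "0 < block_width B"
    and "prod_list B \<le> 2 ^ block_width B"
    and "2 ^ block_width B < 2 * real (prod_list B)"
    and "real (block_width B) = \<lceil>log 2 (real (prod_list B))\<rceil>"
proof -
  let ?l = "log 2 (real (prod_list B))"
  have l: "1 \<le> ?l" using assms by simp
  then show k: "real (block_width B) = \<lceil>?l\<rceil>" by (simp add: block_width_def)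
  then show "0 < block_width B" using l by linarith
  have "2 powr ?l \<le> 2 powr block_width B" using k by (intro powr_mono) auto
  then have "real (prod_list B) \<le> 2 ^ block_width B"
    using assms by (simp add: powr_realpow)
  then show "prod_list B \<le> 2 ^ block_width B"
    by (metis of_nat_le_iff of_nat_numeral of_nat_power)
  \<comment> \<open>A ceiling exceeds its argument by less than 1, which costs a factor below
    2.\<close>
  have "2 powr block_width B < 2 powr (1 + ?l)"
    using k by (intro powr_less_mono) linarith+
  then show "2 ^ block_width B < 2 * real (prod_list B)"
    using assms by (simp add: powr_realpow powr_add)
qed

lemma prod_list_ge_2:
  fixes B :: "nat list"
  assumes "B \<noteq> []" and "\<forall>b\<in>set B. 2 \<le> b"
  shows "2 \<le> prod_list B"
  using assms
proof (induction B)
  case (Cons b B)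
  \<comment> \<open>The tail may be empty, with product 1, so only this weaker bound is carried
    over; the factor \<open>b\<close> supplies the 2.\<close>
  have "1 \<le> prod_list B" using Cons by (cases "B = []") auto
  with Cons.prems show ?case using mult_le_mono[of 2 b 1 "prod_list B"] by simp
qed simp

theorem proposition3p5:
  fixes B :: "nat list" and P k :: nat
    and M :: "'a measure" and R :: "nat \<Rightarrow> 'a \<Rightarrow> bool"
  assumes "length B \<ge> 1"
    and "\<forall>b\<in>set B. b \<ge> 2"
    and "P = prod_list B"
    and "k = nat \<lceil>log 2 (real P)\<rceil>"
    and "fair_bit_source M R"
  shows "(\<integral>\<^sup>+\<omega>. ennreal_of_enat (bits_consumed B (\<lambda>i. R i \<omega>)) \<partial>M)
           = ennreal (real k * (2 ^ k / real P))
       \<and> real k * (2 ^ k / real P) \<le> 2 * real k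
       \<and> 2 * real k = 2 * real_of_int \<lceil>log 2 (real P)\<rceil>"
proof (intro conjI)
  have k: "k = block_width B" using assms(3,4) by (simp add: block_width_def)
  have "B \<noteq> []" using assms(1) by auto
  then have P: "2 \<le> prod_list B" using assms(2) by (rule prod_list_ge_2)
  note bounds = block_width_bounds[OF P]
  \<comment> \<open>Measurability allows the constant \<open>k\<close> to be pulled out of the
    integral.\<close>
  have meas: "(\<lambda>\<omega>. ennreal_of_enat (rounds B (\<lambda>i. R i \<omega>))) \<in> borel_measurable M"
    by (rule measurable_compose[OF measurable_rounds[OF assms(5) bounds(2)]]) simp
  have "(\<integral>\<^sup>+\<omega>. ennreal_of_enat (bits_consumed B (\<lambda>i. R i \<omega>)) \<partial>M)
      = of_nat k * ennreal (2 ^ k / real P)"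
    using P by (simp add: bits_consumed_def ennreal_of_enat_mult_enat nn_integral_cmult[OF meas]
        expected_rounds[OF assms(5) bounds(2)] k assms(3))
  then show "(\<integral>\<^sup>+\<omega>. ennreal_of_enat (bits_consumed B (\<lambda>i. R i \<omega>)) \<partial>M)
      = ennreal (real k * (2 ^ k / real P))"
    by (simp add: ennreal_mult[symmetric] ennreal_of_nat_eq_real_of_nat)
  have "2 ^ k / real P \<le> 2"
    using bounds(3) P by (simp add: k assms(3) field_simps)
  then show "real k * (2 ^ k / real P) \<le> 2 * real k"
    using mult_left_mono[of "2 ^ k / real P" 2 "real k"] by simp
  show "2 * real k = 2 * real_of_int \<lceil>log 2 (real P)\<rceil>"
    using bounds(4) by (simp add: k assms(3))
qed

end
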